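(* For any point $p\in B(Q)$, there is a homeomorphism $h:Q\to Q$ (onto $Q$) such that $h(p)$ is contained in the pseudo-interior $Q^o$ of $Q$.
   Context: The Hilbert cube is $Q=\prod_{i=1}^\infty I_i$ with the product topology, where each $I_i=[-1,1]$. The pseudo-interior of $Q$ is $Q^o=\prod_{i=1}^\infty(-1,1)$, and the pseudo-boundary of $Q$ is $B(Q)=Q\setminus Q^o$. *)

theory Defs
  imports "HOL-Analysis.Analysis"
begin

text \<open>Coordinates are indexed by the type of natural numbers, so they start at 0 instead of 1.\<close>

definition hilbert_cube :: "(nat \<Rightarrow> real) topology" where
  "hilbert_cube = product_topology (\<lambda>i. top_of_set {-1..1}) UNIV"

definition pseudo_interior :: "(nat \<Rightarrow> real) set" where
  "pseudo_interior = (\<Pi>\<^sub>E i\<in>UNIV. {-1<..<1})"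

definition pseudo_boundary :: "(nat \<Rightarrow> real) set" where
  "pseudo_boundary = topspace hilbert_cube - pseudo_interior"

end

theory Submission
  imports Defs
begin

text \<open>
  A carry runs through the coordinates. It starts as \<open>c\<^sub>0 = x\<^sub>0\<close>, and at step \<open>n\<close> a piecewise linear
  homeomorphism of the square turns the pair \<open>(c\<^sub>n, x\<^sub>n\<^sub>+\<^sub>1)\<close> into \<open>(y\<^sub>n, c\<^sub>n\<^sub>+\<^sub>1)\<close>; the map of the cube is
  \<open>x \<mapsto> y\<close>. The homeomorphism pushes the upper half of the side \<open>c\<^sub>n = 1\<close> around the corner into the
  side \<open>c\<^sub>n\<^sub>+\<^sub>1 = 1\<close>, away from the vertices. Hence if \<open>x\<^sub>0 = 1\<close> and all \<open>x\<^sub>n \<ge> 0\<close>, the carry stays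
  equal to \<open>1\<close> forever while every \<open>y\<^sub>n\<close> is interior. Since \<open>c\<^sub>n\<close> depends on \<open>c\<^sub>n\<^sub>+\<^sub>1\<close> through
  a contraction when \<open>y\<^sub>n\<close> is fixed, the sequence \<open>y\<close> determines the carries, so nothing is lost in
  the limit. A permutation and reflections of the coordinates bring any boundary point into the form
  required of \<open>x\<close>.
\<close>

section \<open>A homeomorphism of the square\<close>

text \<open>
  The inverse map \<open>(y, z) \<mapsto> (pull_carry y z, pull_coord y z)\<close> is the cone from the bottom midpoint
  \<open>(0, -1)\<close>, which is fixed, over the piecewise linear boundary map that fixes
  \<open>(1, -1)\<close>, \<open>(-1, 1)\<close>, \<open>(-1, -1)\<close> and sends \<open>(1, 1)\<close> to \<open>(1, -1/2)\<close> and \<open>(0, 1)\<close> to \<open>(1, 1)\<close>.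
  \<open>pull_carry\<close> equals \<open>1\<close> on part of the top side, and placing the apex on the bottom side keeps its
  slope in \<open>z\<close> down to \<open>1/2\<close>; the cone from the centre would have slope \<open>1\<close> there.
\<close>

definition push_coord :: "real \<Rightarrow> real \<Rightarrow> real" where
  "push_coord u x = min u (max ((4 * u - 2 * (x + 1)) / 3) (u / 2 - (x + 1) / 4))"

definition push_carry :: "real \<Rightarrow> real \<Rightarrow> real" where
  "push_carry u x = max (x + 1) (min (4 * (x + 1)) (2 * u)) - 1"

definition pull_carry :: "real \<Rightarrow> real \<Rightarrow> real" where
  "pull_carry y z = max y (min ((z + 1) / 2) (2 * y + (z + 1) / 2))"

definition pull_coord :: "real \<Rightarrow> real \<Rightarrow> real" where
  "pull_coord y z = min (z + 1) (max ((z + 1) / 4) (z + 1 - 3 * y / 2)) - 1"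

text \<open>The formulas are linear on sectors with apex \<open>(0, -1)\<close>; the rays separating
  the sectors pass through \<open>(1, -1/2)\<close>, \<open>(1, 1)\<close> and
  \<open>(-1, 1)\<close>.\<close>

lemma push_cases:
  assumes "x \<ge> -1"
  obtains "x + 1 \<le> u / 2" "push_coord u x = u" "push_carry u x = 4 * x + 3"
  | "u / 2 \<le> x + 1" "x + 1 \<le> 2 * u" "push_coord u x = (4 * u - 2 * (x + 1)) / 3"
    "push_carry u x = 2 * u - 1"
  | "2 * u \<le> x + 1" "-2 * u \<le> x + 1" "push_coord u x = u / 2 - (x + 1) / 4" "push_carry u x = x"
  | "x + 1 \<le> -2 * u" "push_coord u x = u" "push_carry u x = x"
proof -
  consider "x + 1 \<le> u / 2" | "u / 2 \<le> x + 1" "x + 1 \<le> 2 * u"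
    | "2 * u \<le> x + 1" "-2 * u \<le> x + 1" | "x + 1 \<le> -2 * u"
    by linarith
  then show thesis
  proof cases
    case 1
    with assms have "push_coord u x = u" "push_carry u x = 4 * x + 3"
      unfolding push_coord_def push_carry_def by argo+
    with 1 that(1) show thesis by blast
  next
    case 2
    with assms have "push_coord u x = (4 * u - 2 * (x + 1)) / 3" "push_carry u x = 2 * u - 1"
      unfolding push_coord_def push_carry_def by argo+
    with 2 that(2) show thesis by blast
  next
    case 3
    with assms have "push_coord u x = u / 2 - (x + 1) / 4" "push_carry u x = x"
      unfolding push_coord_def push_carry_def by argo+
    with 3 that(3) show thesis by blast
  next
    case 4
    with assms have "push_coord u x = u" "push_carry u x = x"
      unfolding push_coord_def push_carry_def by argo+
    with 4 that(4) show thesis by blast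
  qed
qed

text \<open>The separating rays pass through \<open>(1, 1)\<close>, \<open>(0, 1)\<close> and
  \<open>(-1, 1)\<close>; the inverse map takes them to those of \<open>push_cases\<close>, in this
  order.\<close>

lemma pull_cases:
  assumes "z \<ge> -1"
  obtains "z + 1 \<le> 2 * y" "pull_carry y z = y" "pull_coord y z = (z + 1) / 4 - 1"
  | "0 \<le> y" "2 * y \<le> z + 1" "pull_carry y z = (z + 1) / 2" "pull_coord y z = z - 3 * y / 2"
  | "y \<le> 0" "-2 * y \<le> z + 1" "pull_carry y z = 2 * y + (z + 1) / 2" "pull_coord y z = z"
  | "z + 1 \<le> -2 * y" "pull_carry y z = y" "pull_coord y z = z"
proof -
  consider "z + 1 \<le> 2 * y" | "0 \<le> y" "2 * y \<le> z + 1"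
    | "y \<le> 0" "-2 * y \<le> z + 1" | "z + 1 \<le> -2 * y"
    by linarith
  then show thesis
  proof cases
    case 1
    with assms have "pull_carry y z = y" "pull_coord y z = (z + 1) / 4 - 1"
      unfolding pull_carry_def pull_coord_def by argo+
    with 1 that(1) show thesis by blast
  next
    case 2
    with assms have "pull_carry y z = (z + 1) / 2" "pull_coord y z = z - 3 * y / 2"
      unfolding pull_carry_def pull_coord_def by argo+
    with 2 that(2) show thesis by blast
  next
    case 3
    with assms have "pull_carry y z = 2 * y + (z + 1) / 2" "pull_coord y z = z"
      unfolding pull_carry_def pull_coord_def by argo+
    with 3 that(3) show thesis by blast
  next
    case 4
    with assms have "pull_carry y z = y" "pull_coord y z = z"
      unfolding pull_carry_def pull_coord_def by argo+
    with 4 that(4) show thesis by blast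
  qed
qed

lemma push_in_square:
  assumes "u \<in> {-1..1}" "x \<in> {-1..1}"
  shows "push_coord u x \<in> {-1..1}" "push_carry u x \<in> {-1..1}"
proof -
  have x: "x \<ge> -1" using assms by simp
  have "push_coord u x \<in> {-1..1} \<and> push_carry u x \<in> {-1..1}"
    by (cases rule: push_cases[OF x, of u]) (use assms in \<open>simp_all only: atLeastAtMost_iff, argo+\<close>)
  then show "push_coord u x \<in> {-1..1}" "push_carry u x \<in> {-1..1}" by blast+
qed

lemma pull_in_square:
  assumes "y \<in> {-1..1}" "z \<in> {-1..1}"
  shows "pull_carry y z \<in> {-1..1}" "pull_coord y z \<in> {-1..1}"
proof -
  have z: "z \<ge> -1" using assms by simp
  have "pull_carry y z \<in> {-1..1} \<and> pull_coord y z \<in> {-1..1}"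
    by (cases rule: pull_cases[OF z, of y]) (use assms in \<open>simp_all only: atLeastAtMost_iff, argo+\<close>)
  then show "pull_carry y z \<in> {-1..1}" "pull_coord y z \<in> {-1..1}" by blast+
qed

text \<open>On each sector both identities are linear arithmetic. They hold on a whole half-plane
  because the formulas are homogeneous about the apex.\<close>

lemma pull_push:
  assumes "x \<ge> -1"
  shows "pull_carry (push_coord u x) (push_carry u x) = u"
    and "pull_coord (push_coord u x) (push_carry u x) = x"
proof -
  show "pull_carry (push_coord u x) (push_carry u x) = u"
    by (cases rule: push_cases[OF assms, of u]) (use assms in \<open>simp_all only: pull_carry_def, argo+\<close>)
  show "pull_coord (push_coord u x) (push_carry u x) = x"
    by (cases rule: push_cases[OF assms, of u]) (use assms in \<open>simp_all only: pull_coord_def, argo+\<close>)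
qed

lemma push_pull:
  assumes "z \<ge> -1"
  shows "push_coord (pull_carry y z) (pull_coord y z) = y"
    and "push_carry (pull_carry y z) (pull_coord y z) = z"
proof -
  show "push_coord (pull_carry y z) (pull_coord y z) = y"
    by (cases rule: pull_cases[OF assms, of y]) (use assms in \<open>simp_all only: push_coord_def, argo+\<close>)
  show "push_carry (pull_carry y z) (pull_coord y z) = z"
    by (cases rule: pull_cases[OF assms, of y]) (use assms in \<open>simp_all only: push_carry_def, argo+\<close>)
qed

text \<open>For fixed \<open>y\<close>, every term of the max and min has slope \<open>0\<close> or
  \<open>1/2\<close> in \<open>z\<close>.\<close>

lemma pull_carry_contraction: "\<bar>pull_carry y z - pull_carry y z'\<bar> \<le> \<bar>z - z'\<bar> / 2"
  unfolding pull_carry_def by argo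

lemma pull_carry_mono: "z \<le> z' \<Longrightarrow> pull_carry y z \<le> pull_carry y z'"
  unfolding pull_carry_def by (intro max.mono min.mono) auto

text \<open>The point \<open>(1, x)\<close> lies in the second sector of \<open>push_cases\<close>,
  where \<open>push_coord\<close> is \<open>(2 - 2 * x) / 3\<close>, a value in
  \<open>[0, 2/3]\<close>.\<close>

lemma push_one:
  assumes "x \<in> {0..1}"
  shows "push_coord 1 x \<in> {-1<..<1}" "push_carry 1 x = 1"
  using assms unfolding push_coord_def push_carry_def atLeastAtMost_iff greaterThanLessThan_iff
  by argo+

section \<open>The carrying map of the Hilbert cube\<close>

primrec carry :: "(nat \<Rightarrow> real) \<Rightarrow> nat \<Rightarrow> real" where
  "carry x 0 = x 0"
| "carry x (Suc n) = push_carry (carry x n) (x (Suc n))"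

definition carry_map :: "(nat \<Rightarrow> real) \<Rightarrow> nat \<Rightarrow> real" where
  "carry_map x n = push_coord (carry x n) (x (Suc n))"

lemma in_hilbert_cube_iff: "x \<in> topspace hilbert_cube \<longleftrightarrow> (\<forall>i. x i \<in> {-1..1})"
  by (auto simp: hilbert_cube_def PiE_UNIV_domain)

lemma in_pseudo_interior_iff: "x \<in> pseudo_interior \<longleftrightarrow> (\<forall>i. x i \<in> {-1<..<1})"
  by (auto simp: pseudo_interior_def PiE_UNIV_domain)

lemma carry_in_interval:
  assumes "x \<in> topspace hilbert_cube"
  shows "carry x n \<in> {-1..1}"
proof (induction n)
  case 0
  then show ?case using assms by (simp add: in_hilbert_cube_iff)
next
  case (Suc n)
  then show ?case using assms push_in_square(2) in_hilbert_cube_iff by (metis carry.simps(2))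
qed

lemma carry_map_in_hilbert_cube:
  "x \<in> topspace hilbert_cube \<Longrightarrow> carry_map x \<in> topspace hilbert_cube"
  using carry_in_interval push_in_square(1) by (simp add: in_hilbert_cube_iff carry_map_def)

section \<open>Continuity of the carrying map\<close>

lemma continuous_map_into_hilbert_cube:
  assumes "\<And>i. continuous_map X euclideanreal (\<lambda>x. f x i)"
    and "\<And>x. x \<in> topspace X \<Longrightarrow> f x \<in> topspace hilbert_cube"
  shows "continuous_map X hilbert_cube f"
proof -
  have "f x i \<in> {-1..1}" if "x \<in> topspace X" for x i
    using assms(2)[OF that] by (simp add: in_hilbert_cube_iff)
  then show ?thesis
    unfolding hilbert_cube_def continuous_map_componentwise_UNIV continuous_map_in_subtopology
    using assms(1) by blast
qed

lemma continuous_map_hilbert_cube_coord: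
  "continuous_map hilbert_cube euclideanreal (\<lambda>x. x i)"
  using continuous_map_product_projection[of i UNIV "\<lambda>i. top_of_set {-1..1::real}"]
  by (simp add: hilbert_cube_def continuous_map_in_subtopology)

lemma continuous_map_carry: "continuous_map hilbert_cube euclideanreal (\<lambda>x. carry x n)"
proof (induction n)
  case 0
  then show ?case by (simp add: continuous_map_hilbert_cube_coord)
next
  case (Suc n)
  then show ?case
    unfolding carry.simps push_carry_def
    by (intro continuous_map_real_min continuous_map_real_max continuous_map_real_mult
        continuous_map_diff continuous_map_add continuous_map_const[THEN iffD2]
        continuous_map_hilbert_cube_coord) auto
qed

lemma continuous_map_carry_map: "continuous_map hilbert_cube hilbert_cube carry_map"
proof (rule continuous_map_into_hilbert_cube)
  show "continuous_map hilbert_cube euclideanreal (\<lambda>x. carry_map x n)" for n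
    unfolding carry_map_def push_coord_def divide_inverse
    by (intro continuous_map_real_min continuous_map_real_max continuous_map_real_mult
        continuous_map_diff continuous_map_add continuous_map_const[THEN iffD2]
        continuous_map_hilbert_cube_coord continuous_map_carry) auto
qed (rule carry_map_in_hilbert_cube)

section \<open>Bijectivity of the carrying map\<close>

lemma inj_on_carry_map: "inj_on carry_map (topspace hilbert_cube)"
proof (rule inj_onI)
  fix x x' assume x: "x \<in> topspace hilbert_cube" and x': "x' \<in> topspace hilbert_cube"
    and eq: "carry_map x = carry_map x'"
  have pull: "pull_carry (carry_map w n) (carry w (Suc n)) = carry w n"
    "pull_coord (carry_map w n) (carry w (Suc n)) = w (Suc n)"
    if "w \<in> topspace hilbert_cube" for w n
    using that pull_push[of "w (Suc n)" "carry w n"] by (auto simp: carry_map_def in_hilbert_cube_iff)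
  \<comment> \<open>The two carries at index \<open>n + k\<close> differ by at most
    \<open>2\<close>, the length of \<open>[-1, 1]\<close>; each of the \<open>k\<close> steps back
    to \<open>n\<close> uses the same output and halves the difference.\<close>
  have "\<bar>carry x n - carry x' n\<bar> \<le> 2 * (1/2) ^ k" for n k
  proof (induction k arbitrary: n)
    case 0
    then show ?case using carry_in_interval[OF x, of n] carry_in_interval[OF x', of n] by auto
  next
    case (Suc k)
    have "\<bar>carry x n - carry x' n\<bar> \<le> \<bar>carry x (Suc n) - carry x' (Suc n)\<bar> / 2"
      using pull_carry_contraction pull(1)[OF x] pull(1)[OF x'] eq by metis
    with Suc[of "Suc n"] show ?case by simp
  qed
  moreover have "(\<lambda>k. 2 * (1/2::real) ^ k) \<longlonglongrightarrow> 0"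
    using tendsto_mult_right_zero[OF LIMSEQ_power_zero[of "1/2::real"]] by simp
  ultimately have "\<bar>carry x n - carry x' n\<bar> \<le> 0" for n
    by (meson LIMSEQ_le_const)
  then have carry_eq: "carry x n = carry x' n" for n by simp
  show "x = x'"
  proof
    fix i show "x i = x' i"
      using carry_eq[of 0] carry_eq pull(2)[OF x] pull(2)[OF x'] eq by (cases i) (simp, metis)
  qed
qed

text \<open>A preimage of \<open>y\<close> needs carries compatible with all outputs at once. They
  arise as limits of carries pulled back from ever later indices.\<close>

lemma ex_backward_orbit:
  assumes y: "y \<in> topspace hilbert_cube"
  shows "\<exists>z. (\<forall>n. z n \<in> {-1..1}) \<and> (\<forall>n. z n = pull_carry (y n) (z (Suc n)))"
proof -
  \<comment> \<open>\<open>b k n\<close> is the carry at \<open>n\<close> obtained by pulling back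
    \<open>k\<close> steps from the value \<open>-1\<close> at \<open>n + k\<close>. As
    \<open>-1\<close> is the least possible carry and pulling back is monotone, \<open>b k n\<close>
    increases with \<open>k\<close>.\<close>
  define b where "b = rec_nat (\<lambda>n. -1) (\<lambda>k c n. pull_carry (y n) (c (Suc n)))"
  have b_simps: "b 0 n = -1" "b (Suc k) n = pull_carry (y n) (b k (Suc n))" for k n
    by (simp_all add: b_def)
  have b_in: "b k n \<in> {-1..1}" for k n
    using y by (induction k arbitrary: n)
      (simp add: b_simps, metis b_simps(2) in_hilbert_cube_iff pull_in_square(1))
  have "b k n \<le> b (Suc k) n" for k n
  proof (induction k arbitrary: n)
    case 0
    then show ?case using b_in[of "Suc 0" n] b_simps(1) by auto
  next
    case (Suc k)
    then show ?case using pull_carry_mono b_simps(2) by metis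
  qed
  then have "incseq (\<lambda>k. b k n)" for n by (rule incseq_SucI)
  then have "\<exists>l. (\<lambda>k. b k n) \<longlonglongrightarrow> l" for n
    using incseq_convergent[of "\<lambda>k. b k n" 1] b_in by (metis atLeastAtMost_iff)
  then obtain z where z: "(\<lambda>k. b k n) \<longlonglongrightarrow> z n" for n by metis
  have "z n \<in> {-1..1}" for n
    by (rule closed_sequentially[OF closed_atLeastAtMost b_in z])
  moreover have "z n = pull_carry (y n) (z (Suc n))" for n
  proof -
    have "(\<lambda>k. pull_carry (y n) (b k (Suc n))) \<longlonglongrightarrow> pull_carry (y n) (z (Suc n))"
      unfolding pull_carry_def by (intro tendsto_intros z tendsto_max tendsto_min) auto
    then have "(\<lambda>k. b (Suc k) n) \<longlonglongrightarrow> pull_carry (y n) (z (Suc n))"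
      by (simp add: b_simps)
    with z[of n] show ?thesis
      using LIMSEQ_Suc LIMSEQ_unique by blast
  qed
  ultimately show ?thesis by blast
qed

lemma carry_map_surj:
  assumes y: "y \<in> topspace hilbert_cube"
  shows "y \<in> carry_map ` topspace hilbert_cube"
proof -
  obtain z where z_in: "z n \<in> {-1..1}" and z: "pull_carry (y n) (z (Suc n)) = z n" for n
    using ex_backward_orbit[OF y] by metis
  \<comment> \<open>The initial carry is the coordinate at \<open>0\<close>, so \<open>z 0\<close>
    goes there; the other coordinates are read off by the inverse square map.\<close>
  define x where "x = case_nat (z 0) (\<lambda>n. pull_coord (y n) (z (Suc n)))"
  have x_Suc: "x (Suc n) = pull_coord (y n) (z (Suc n))" for n by (simp add: x_def)
  have push: "push_coord (z n) (x (Suc n)) = y n" "push_carry (z n) (x (Suc n)) = z (Suc n)" for n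
    using push_pull[of "z (Suc n)" "y n"] z_in[of "Suc n"] z[of n] by (auto simp: x_Suc)
  have carry: "carry x n = z n" for n
    by (induction n) (simp add: x_def, simp add: push(2))
  have "x i \<in> {-1..1}" for i
    using z_in y pull_in_square(2) by (cases i) (auto simp: x_def in_hilbert_cube_iff simp del: atLeastAtMost_iff)
  then have "x \<in> topspace hilbert_cube" by (simp add: in_hilbert_cube_iff)
  moreover have "carry_map x = y" by (auto simp: carry_map_def carry push(1))
  ultimately show ?thesis by blast
qed

lemma homeomorphic_map_carry_map: "homeomorphic_map hilbert_cube hilbert_cube carry_map"
proof (rule continuous_imp_homeomorphic_map)
  show "compact_space hilbert_cube"
    by (simp add: hilbert_cube_def compact_space_product_topology compact_space_subtopology)
  show "Hausdorff_space hilbert_cube"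
    by (simp add: hilbert_cube_def Hausdorff_space_product_topology Hausdorff_space_subtopology)
  show "carry_map ` topspace hilbert_cube = topspace hilbert_cube"
    using carry_map_in_hilbert_cube carry_map_surj by blast
qed (fact continuous_map_carry_map inj_on_carry_map)+

section \<open>Moving a boundary point into the interior\<close>

lemma carry_map_in_pseudo_interior:
  assumes "x 0 = 1" "\<And>i. x i \<in> {0..1}"
  shows "carry_map x \<in> pseudo_interior"
proof -
  have "carry x n = 1" for n
    by (induction n) (use assms push_one(2) in auto)
  then show ?thesis
    using push_one(1)[OF assms(2)] by (simp add: in_pseudo_interior_iff carry_map_def)
qed

lemma homeomorphic_map_signed_transpose:
  fixes s :: "nat \<Rightarrow> real"
  assumes s: "\<And>i. s i \<in> {-1, 1}"
  shows "homeomorphic_map hilbert_cube hilbert_cube (\<lambda>x i. s i * x (Transposition.transpose a b i))"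
proof -
  let ?t = "Transposition.transpose a b"
  have sgn: "s i = 1 \<or> s i = -1" for i using s[of i] by auto
  have continuous: "continuous_map hilbert_cube hilbert_cube (\<lambda>x i. r i * x (?t i))"
    if r: "\<And>i. r i = 1 \<or> r i = -1" for r :: "nat \<Rightarrow> real"
  proof (rule continuous_map_into_hilbert_cube)
    show "continuous_map hilbert_cube euclideanreal (\<lambda>x. r i * x (?t i))" for i
      by (intro continuous_intros continuous_map_hilbert_cube_coord)
    show "(\<lambda>i. r i * x (?t i)) \<in> topspace hilbert_cube" if x: "x \<in> topspace hilbert_cube" for x
      unfolding in_hilbert_cube_iff
    proof
      fix i
      show "r i * x (?t i) \<in> {-1..1}"
        using r[of i] x[unfolded in_hilbert_cube_iff, rule_format, of "?t i"] by auto
    qed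
  qed
  have invol: "s i * (s i * v) = v" for i v using sgn[of i] by auto
  \<comment> \<open>The inverse has the same form, but its signs are permuted: solving
    \<open>y i = s i * x (?t i)\<close> for \<open>x i\<close> gives
    \<open>s (?t i) * y (?t i)\<close>.\<close>
  have "homeomorphic_maps hilbert_cube hilbert_cube
      (\<lambda>x i. s i * x (?t i)) (\<lambda>x i. s (?t i) * x (?t i))"
    using continuous[of s] continuous[of "\<lambda>i. s (?t i)"] sgn
    by (simp add: homeomorphic_maps_def invol)
  then show ?thesis using homeomorphic_maps_map by blast
qed

theorem theorem5p1:
  fixes p :: "nat \<Rightarrow> real"
  assumes "p \<in> pseudo_boundary"
  shows "\<exists>h. homeomorphic_map hilbert_cube hilbert_cube h \<and> h p \<in> pseudo_interior"
proof -
  have p: "\<bar>p i\<bar> \<le> 1" for i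
    using assms by (force simp: pseudo_boundary_def in_hilbert_cube_iff abs_le_iff)
  obtain k where k: "p k \<notin> {-1<..<1}"
    using assms by (auto simp: pseudo_boundary_def in_pseudo_interior_iff)
  with p[of k] have "\<bar>p k\<bar> = 1" by (auto simp: abs_if)
  let ?t = "Transposition.transpose 0 k"
  \<comment> \<open>These signs make all coordinates of the image of \<open>p\<close> nonnegative,
    and the transposition puts \<open>\<bar>p k\<bar> = 1\<close> at index \<open>0\<close>.\<close>
  define s where "s i = (if p (?t i) < 0 then -1 else 1::real)" for i
  define g where "g = (\<lambda>x i. s i * x (?t i))"
  have "homeomorphic_map hilbert_cube hilbert_cube g"
    unfolding g_def by (rule homeomorphic_map_signed_transpose) (simp add: s_def)
  then have "homeomorphic_map hilbert_cube hilbert_cube (carry_map \<circ> g)"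
    using homeomorphic_map_carry_map by (rule homeomorphic_map_compose)
  moreover have "g p = (\<lambda>i. \<bar>p (?t i)\<bar>)"
    by (auto simp: g_def s_def)
  then have "carry_map (g p) \<in> pseudo_interior"
    using p \<open>\<bar>p k\<bar> = 1\<close> by (intro carry_map_in_pseudo_interior) auto
  ultimately show ?thesis by (metis comp_apply)
qed

end
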